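(* Let $(X,d,\mu)$ be a metric measure space satisfying the standing assumptions (i) and (ii) of the context. Let $0<p_0\le p_1\le\infty$ satisfy $p_0<\infty$, let $0<\theta<1$, and define $p$ by $\frac1p=\frac{1-\theta}{p_0}+\frac{\theta}{p_1}$. Given $f\in\mathcal C_c(X)$ and $\varepsilon>0$, there exist $N_\varepsilon$, functions $h_j^\varepsilon\in\mathcal C_c(X)$ supported in pairwise disjoint open sets $U_j^\varepsilon$, $j=1,\dots,N_\varepsilon$, and nonzero complex constants $c_j^\varepsilon$ such that the functions $$f_z^\varepsilon=\sum_{j=1}^{N_\varepsilon}|c_j^\varepsilon|^{\frac p{p_0}(1-z)+\frac p{p_1}z}\,h_j^\varepsilon\qquad(z\in\mathbb C)$$ satisfy $$\|f_\theta^\varepsilon-f\|_{L^{p_0}}\le\varepsilon,\qquad\begin{cases}\|f_\theta^\varepsilon-f\|_{L^{p_1}}\le\varepsilon&\text{if }p_1<\infty,\\ \|f_\theta^\varepsilon\|_{L^\infty}\le\|f\|_{L^\infty}+\varepsilon&\text{if }p_1=\infty,\end{cases}$$ and, for all $t\in\mathbb R$, $$\|f_{it}^\varepsilon\|_{L^{p_0}}^{p_0}\le\|f\|_{L^p}^p+\varepsilon',\qquad \|f_{1+it}^\varepsilon\|_{L^{p_1}}\le\big(\|f\|_{L^p}^p+\varepsilon'\big)^{1/p_1},$$ where $\varepsilon'$ depends on $\varepsilon$, $p$, $\|f\|_{L^p}$ and tends to zero as $\varepsilon\to0$.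
   Context: Standing assumptions: $X$ is a metric space with metric $d$, and $\mu$ is a positive measure on a $\sigma$-algebra $\mathcal A$ of subsets of $X$ containing the Borel sets, such that, with $B(x,r)=\{y\in X: d(x,y)<r\}$: (i) $\mu(B(x,r))<\infty$ for every $x\in X$ and $r>0$; (ii) $\mu$ is regular: for every $A\in\mathcal A$ with $\mu(A)<\infty$, $\mu(A)=\sup\{\mu(K): K\subset A,\ K\text{ compact}\}$ and $\mu(A)=\inf\{\mu(U): U\supset A,\ U\text{ open}\}$. $\mathcal C_c(X)$ is the space of continuous complex-valued functions with compact support on $X$. All norms are over $(X,\mu)$, with $\|f\|_{L^p}=(\int|f|^p\,d\mu)^{1/p}$ also for $0<p<1$. When $p_1=\infty$, $1/p_1$ and $p/p_1$ are interpreted as $0$ (so the right side of the last inequality is $1$). *)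

theory Defs
  imports "HOL-Analysis.Analysis" "HOL-Probability.Essential_Supremum"
begin

text \<open>The \<open>\<sigma>\<close>-algebra may be strictly larger than the Borel one, as for a completed measure.\<close>

locale metric_measure_space =
  fixes M :: "'a::metric_space measure"
  assumes space_eq_UNIV: "space M = UNIV"
    and borel_subset: "sets borel \<subseteq> sets M"
    and finite_ball: "\<And>x r. 0 < r \<Longrightarrow> emeasure M (ball x r) < \<infinity>"
    and inner_regular: "\<And>A. A \<in> sets M \<Longrightarrow> emeasure M A < \<infinity> \<Longrightarrow>
          emeasure M A = (SUP K\<in>{K. K \<subseteq> A \<and> compact K}. emeasure M K)"
    and outer_regular: "\<And>A. A \<in> sets M \<Longrightarrow> emeasure M A < \<infinity> \<Longrightarrow>
          emeasure M A = (INF U\<in>{U. A \<subseteq> U \<and> open U}. emeasure M U)"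

definition supp :: "('a::topological_space \<Rightarrow> complex) \<Rightarrow> 'a set"
  where "supp f = closure (support_on UNIV f)"

definition Cc :: "('a::topological_space \<Rightarrow> complex) set"
  where "Cc = {f. continuous_on UNIV f \<and> compact (supp f)}"

text \<open>The exponent reciprocal \<open>1/q\<close> for \<open>0 < q \<le> \<infinity>\<close>, with \<open>1/\<infinity> = 0\<close>.\<close>

definition recip :: "ennreal \<Rightarrow> real"
  where "recip q = enn2real (1 / q)"

lemma recip_top [simp]: "recip \<infinity> = 0"
  by (simp add: recip_def)

lemma recip_ennreal: "0 < r \<Longrightarrow> recip (ennreal r) = 1 / r"
  unfolding recip_def
  by (metis divide_ennreal enn2real_ennreal ennreal_1 less_eq_real_def zero_le_divide_1_iff zero_le_one)

text \<open>Real powers \<open>x\<^sup>a\<close> with \<open>0 \<le> a\<close> in \<open>[0,\<infinity>]\<close>. Unlike for \<open>powr\<close> on the reals, \<open>x\<^sup>0 = 1\<close>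
  also for \<open>x = 0\<close>, so that a \<open>1/p\<^sub>1\<close>-th power is \<open>1\<close> when \<open>p\<^sub>1 = \<infinity>\<close>.\<close>

definition epow :: "ennreal \<Rightarrow> real \<Rightarrow> ennreal"
  where "epow x a = (if a = 0 then 1 else if x = \<infinity> then \<infinity> else ennreal (enn2real x powr a))"

text \<open>The \<open>L\<^sup>q\<close> (quasi-)norm for \<open>0 < q \<le> \<infinity>\<close>, with value \<open>\<infinity>\<close> outside \<open>L\<^sup>q\<close>. The essential
  supremum is taken in \<open>[0,\<infinity>]\<close>, so it is \<open>0\<close> for the zero measure.\<close>

definition Lp_norm :: "'a measure \<Rightarrow> ennreal \<Rightarrow> ('a \<Rightarrow> complex) \<Rightarrow> ennreal"
  where "Lp_norm M q f =
    (if q = \<infinity> then esssup M (\<lambda>x. ennreal (norm (f x)))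
     else epow (\<integral>\<^sup>+ x. ennreal (norm (f x) powr enn2real q) \<partial>M) (recip q))"

definition interp_family ::
  "real \<Rightarrow> ennreal \<Rightarrow> real \<Rightarrow> nat \<Rightarrow> (nat \<Rightarrow> complex) \<Rightarrow> (nat \<Rightarrow> 'a \<Rightarrow> complex) \<Rightarrow> complex \<Rightarrow> 'a \<Rightarrow> complex"
  where "interp_family p0 p1 p N c h z x =
    (\<Sum>j = 1..N. complex_of_real (norm (c j))
        powr (complex_of_real (p / p0) * (1 - z) + complex_of_real (p * recip p1) * z) * h j x)"

end

theory Submission
  imports Defs "HOL-Real_Asymp.Real_Asymp"
begin

text \<open>
  The function \<open>f\<close> is sliced by the size of its modulus. For a mesh \<open>t > 0\<close>, the open sets
  \<open>U\<^sub>j = {t j < |f| < t (j + 1)}\<close> with \<open>j \<ge> 1\<close> are pairwise disjoint; on \<open>U\<^sub>j\<close> take \<open>c\<^sub>j = t j\<close> and let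
  \<open>h\<^sub>j\<close> be the phase \<open>f / |f|\<close> times a continuous cutoff, a function of \<open>|f|\<close> with values in \<open>[0, 1]\<close>,
  that vanishes within relative distance \<open>d\<close> of the two ends of the slab. Where \<open>|f| \<le> t\<close>
  all the \<open>h\<^sub>j\<close> are \<open>0\<close>.

  Using the lower end of the slab as constant makes every size estimate hold pointwise. At
  \<open>x \<in> U\<^sub>j\<close> only the \<open>j\<close>-th term survives, so \<open>|f\<^sub>z x| \<le> c\<^sub>j powr a\<close>, where \<open>a\<close> is the real part of the
  exponent. It is \<open>p / p\<^sub>0\<close> on \<open>Re z = 0\<close>, it is \<open>p / p\<^sub>1\<close> on \<open>Re z = 1\<close>, and at \<open>z = \<theta>\<close> it is \<open>1\<close>
  by the definition of \<open>p\<close>. As \<open>c\<^sub>j < |f x|\<close>, this gives \<open>|f\<^sub>i\<^sub>t|\<close> to the power \<open>p\<^sub>0\<close> and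
  \<open>|f\<^sub>1\<^sub>+\<^sub>i\<^sub>t|\<close> to the power \<open>p\<^sub>1\<close> at most \<open>|f|\<close> to the power \<open>p\<close> (or \<open>|f\<^sub>1\<^sub>+\<^sub>i\<^sub>t| \<le> 1\<close> if \<open>p\<^sub>1 = \<infinity>\<close>), and \<open>|f\<^sub>\<theta>| \<le> |f|\<close>. The bounds on
  the two boundary lines therefore hold without any error term, and \<open>E = 0\<close> is a valid choice
  (\<open>norm_interp_family_slices_powr_le\<close>).

  What remains is to make \<open>f\<^sub>\<theta> - f\<close> small. Away from the places where \<open>|f|\<close> is close to a level
  \<open>t k\<close> with \<open>k \<ge> 1\<close>, either \<open>|f| < t\<close> or the cutoff is \<open>1\<close>, and the error is at most \<open>t\<close>; on this exceptional set, the
  collar, it is still at most \<open>|f|\<close> (\<open>norm_interp_family_slices_sub_le\<close>). The set \<open>{f \<noteq> 0}\<close> lies in a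
  ball and has finite measure, so a small \<open>t\<close> settles the first part. As \<open>d\<close> tends to \<open>0\<close> the collars
  shrink to the union of the level sets \<open>{|f| = t k}\<close>. Only countably many nonzero values of \<open>|f|\<close>
  can be taken on a set of positive measure, so \<open>t\<close> can be chosen with all these level sets null
  (\<open>exists_uncharged_mesh\<close>); then a small \<open>d\<close> settles the second part. Since two
  exponents \<open>p\<^sub>0\<close> and \<open>p\<^sub>1\<close> have to be served by one \<open>t\<close> and one \<open>d\<close>, \<open>slices_approximate\<close>
  handles a finite set of exponents.
\<close>

section \<open>Powers and quasi-norms\<close>

lemma epow_ennreal: "0 < a \<Longrightarrow> 0 \<le> r \<Longrightarrow> epow (ennreal r) a = ennreal (r powr a)"
  by (simp add: epow_def)

lemma epow_mono:
  assumes "x \<le> y" "0 \<le> a"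
  shows "epow x a \<le> epow y a"
  using assms
  by (cases x; cases y) (auto simp: epow_def top_unique intro!: ennreal_leI powr_mono2)

lemma epow_inverse:
  assumes "0 < q"
  shows "epow (epow x (1 / q)) q = x"
  using assms by (cases x) (auto simp: epow_def powr_powr)

lemma Lp_norm_ennreal:
  "0 < q \<Longrightarrow> Lp_norm M (ennreal q) g = epow (\<integral>\<^sup>+ x. ennreal (norm (g x) powr q) \<partial>M) (1 / q)"
  by (simp add: Lp_norm_def recip_ennreal)

lemma epow_Lp_norm:
  "0 < q \<Longrightarrow> epow (Lp_norm M (ennreal q) g) q = (\<integral>\<^sup>+ x. ennreal (norm (g x) powr q) \<partial>M)"
  by (simp add: Lp_norm_ennreal epow_inverse)

lemma Lp_norm_leI:
  assumes "0 < q" "0 \<le> e" "(\<integral>\<^sup>+ x. ennreal (norm (g x) powr q) \<partial>M) \<le> ennreal (e powr q)"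
  shows "Lp_norm M (ennreal q) g \<le> ennreal e"
proof -
  have "Lp_norm M (ennreal q) g \<le> epow (ennreal (e powr q)) (1 / q)"
    using assms by (simp add: Lp_norm_ennreal epow_mono)
  also have "\<dots> = ennreal e"
    using assms by (simp add: epow_ennreal powr_powr)
  finally show ?thesis .
qed

section \<open>Levels of positive measure\<close>

text \<open>These levels are the atoms other than \<open>0\<close> of the distribution of \<open>g\<close>. The measure is cut down to
  \<open>{g \<noteq> 0}\<close>, which makes this distribution finite.\<close>

lemma countable_charged_levels:
  fixes g :: "'a \<Rightarrow> real"
  assumes [measurable]: "g \<in> borel_measurable M"
    and fin: "emeasure M {x \<in> space M. g x \<noteq> 0} < \<infinity>"
  shows "countable {r. r \<noteq> 0 \<and> emeasure M {x \<in> space M. g x = r} \<noteq> 0}"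
proof -
  define K where "K = {x \<in> space M. g x \<noteq> 0}"
  have [measurable]: "K \<in> sets M" unfolding K_def by measurable
  define D where "D = distr (density M (indicator K)) borel g"
  have D: "emeasure D A = emeasure M (K \<inter> (g -` A \<inter> space M))" if "A \<in> sets borel" for A
  proof -
    have [measurable]: "g -` A \<inter> space M \<in> sets M" using that by measurable
    have "emeasure D A = (\<integral>\<^sup>+ x. indicator K x * indicator (g -` A \<inter> space M) x \<partial>M)"
      using that by (simp add: D_def emeasure_distr emeasure_density)
    also have "\<dots> = (\<integral>\<^sup>+ x. indicator (K \<inter> (g -` A \<inter> space M)) x \<partial>M)"
      by (simp add: indicator_inter_arith)
    finally show ?thesis by simp
  qed
  interpret D: finite_measure D
  proof (rule finite_measureI)
    have "emeasure D (space D) = emeasure M (K \<inter> (g -` UNIV \<inter> space M))"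
      by (subst D[symmetric]) (auto simp: D_def)
    also have "K \<inter> (g -` UNIV \<inter> space M) = K" by (auto simp: K_def)
    finally show "emeasure D (space D) \<noteq> \<infinity>" using fin by (simp add: K_def)
  qed
  have "{r. r \<noteq> 0 \<and> emeasure M {x \<in> space M. g x = r} \<noteq> 0} \<subseteq> {r. measure D {r} \<noteq> 0}"
  proof (intro subsetI CollectI notI)
    fix r assume "r \<in> {r. r \<noteq> 0 \<and> emeasure M {x \<in> space M. g x = r} \<noteq> 0}"
      and "measure D {r} = 0"
    then have r: "r \<noteq> 0" "emeasure M {x \<in> space M. g x = r} \<noteq> 0" "measure D {r} = 0" by auto
    have "emeasure D {r} = emeasure M (K \<inter> (g -` {r} \<inter> space M))" by (rule D) simp
    also have "K \<inter> (g -` {r} \<inter> space M) = {x \<in> space M. g x = r}" using r by (auto simp: K_def)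
    finally show False using r by (simp add: D.emeasure_eq_measure)
  qed
  then show ?thesis using D.countable_support countable_subset by blast
qed

text \<open>A bad \<open>t\<close> is a charged level divided by some \<open>k\<close>, so the bad values form a countable set, which
  cannot contain an interval.\<close>

lemma exists_uncharged_mesh:
  fixes g :: "'a \<Rightarrow> real"
  assumes "g \<in> borel_measurable M" "emeasure M {x \<in> space M. g x \<noteq> 0} < \<infinity>" "0 < \<tau>"
  obtains t where "0 < t" "t < \<tau>"
    "\<And>k::nat. 1 \<le> k \<Longrightarrow> emeasure M {x \<in> space M. g x = t * real k} = 0"
proof -
  let ?C = "{r. r \<noteq> 0 \<and> emeasure M {x \<in> space M. g x = r} \<noteq> 0}"
  let ?bad = "\<Union>k::nat. (\<lambda>r. r / real k) ` ?C"
  have "countable ?bad" using countable_charged_levels[OF assms(1,2)] by blast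
  then have "\<not> {0<..<\<tau>} \<subseteq> ?bad"
    using uncountable_open_interval[of 0 \<tau>] assms(3) countable_subset by blast
  then obtain t where t: "0 < t" "t < \<tau>" "t \<notin> ?bad" by (meson greaterThanLessThan_iff subsetI)
  have "emeasure M {x \<in> space M. g x = t * real k} = 0" if "1 \<le> k" for k :: nat
  proof (rule ccontr)
    assume "emeasure M {x \<in> space M. g x = t * real k} \<noteq> 0"
    then have "t * real k \<in> ?C" using t that by auto
    moreover have "t = t * real k / real k" using that by simp
    ultimately show False using t(3) by blast
  qed
  then show thesis using that t by blast
qed

section \<open>Slicing a function by its modulus\<close>

text \<open>The trapezoidal cutoff on the unit interval, for \<open>0 < d \<le> 1 / 4\<close>: \<open>0\<close> outside \<open>{d..1 - d}\<close>, \<open>1\<close> on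
  \<open>{2 * d..1 - 2 * d}\<close>, and linear in between.\<close>

definition plateau :: "real \<Rightarrow> real \<Rightarrow> real"
  where "plateau d u = max 0 (min 1 ((min u (1 - u) - d) / d))"

lemma plateau_nonneg: "0 \<le> plateau d u" and plateau_le_1: "plateau d u \<le> 1"
  by (simp_all add: plateau_def)

lemma plateau_nonzeroD:
  assumes "plateau d u \<noteq> 0" "0 < d"
  shows "d \<le> u" "u \<le> 1 - d"
proof -
  have "\<not> (min u (1 - u) - d) / d \<le> 0" using assms(1) by (auto simp: plateau_def)
  then have "0 < (min u (1 - u) - d) / d" by linarith
  then show "d \<le> u" "u \<le> 1 - d" using assms(2) by (auto simp: zero_less_divide_iff)
qed

lemma plateau_eq_1:
  assumes "0 < d" "2 * d \<le> u" "u \<le> 1 - 2 * d"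
  shows "plateau d u = 1"
proof -
  have "1 \<le> (min u (1 - u) - d) / d" using assms by (simp add: le_divide_eq)
  then show ?thesis by (simp add: plateau_def)
qed

definition slab :: "real \<Rightarrow> ('a \<Rightarrow> complex) \<Rightarrow> nat \<Rightarrow> 'a set"
  where "slab t f j = {x. t * real j < norm (f x) \<and> norm (f x) < t * (real j + 1)}"

text \<open>The quotient stands for the phase \<open>f / |f|\<close> times the cutoff: wherever the cutoff is nonzero,
  the maximum equals \<open>|f x|\<close>. For \<open>j \<ge> 1\<close> the maximum is bounded below by \<open>t\<close>, so that the
  function is visibly continuous across the zeros of \<open>f\<close>.\<close>

definition slice :: "real \<Rightarrow> real \<Rightarrow> ('a \<Rightarrow> complex) \<Rightarrow> nat \<Rightarrow> 'a \<Rightarrow> complex"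
  where "slice t d f j x =
    f x * of_real (plateau d (norm (f x) / t - real j) / max (norm (f x)) (t * real j))"

lemma norm_slice_le_1: "norm (slice t d f j x) \<le> 1"
proof (cases "f x = 0")
  case False
  then have m: "0 < max (norm (f x)) (t * real j)" by (simp add: less_max_iff_disj)
  have "norm (slice t d f j x) = norm (f x) / max (norm (f x)) (t * real j) * plateau d (norm (f x) / t - real j)"
    by (simp add: slice_def norm_mult norm_divide plateau_nonneg le_max_iff_disj)
  also have "\<dots> \<le> 1 * 1"
    using m by (intro mult_mono plateau_le_1 plateau_nonneg) (simp_all only: divide_le_eq, auto)
  finally show ?thesis by simp
qed (simp add: slice_def)

lemma slice_nonzeroD:
  assumes "slice t d f j x \<noteq> 0" "0 < t" "0 < d"
  shows "t * (real j + d) \<le> norm (f x)" "norm (f x) \<le> t * (real j + 1 - d)" "f x \<noteq> 0"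
proof -
  have "plateau d (norm (f x) / t - real j) \<noteq> 0" and "f x \<noteq> 0" using assms by (auto simp: slice_def)
  from plateau_nonzeroD[OF this(1) assms(3)] this(2)
  show "t * (real j + d) \<le> norm (f x)" "norm (f x) \<le> t * (real j + 1 - d)" "f x \<noteq> 0"
    using assms(2) by (auto simp: field_simps)
qed

lemma slice_zero_outside_slab:
  assumes "x \<notin> slab t f j" "0 < t" "0 < d"
  shows "slice t d f j x = 0"
proof (rule ccontr)
  assume "slice t d f j x \<noteq> 0"
  from slice_nonzeroD[OF this assms(2,3)] assms
  show False by (auto simp: slab_def algebra_simps mult_less_cancel_left) (smt (verit) mult_pos_pos)+
qed

lemma slice_on_plateau:
  assumes "0 < t" "0 < d" "2 * d \<le> norm (f x) / t - real j" "norm (f x) / t - real j \<le> 1 - 2 * d"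
  shows "slice t d f j x = f x / of_real (norm (f x))"
proof -
  have "t * real j \<le> norm (f x)"
  proof -
    have "real j \<le> norm (f x) / t" using assms by linarith
    then show ?thesis using assms(1) by (simp add: field_simps)
  qed
  then show ?thesis by (simp add: slice_def plateau_eq_1[OF assms(2-4)] max_absorb1)
qed

lemma open_slab:
  assumes "continuous_on UNIV f"
  shows "open (slab t f j)"
  unfolding slab_def by (intro open_Collect_conj open_Collect_less continuous_intros assms)

lemma disjoint_slabs:
  assumes "0 < t"
  shows "disjoint_family_on (slab t f) A"
proof -
  have "i = j" if "x \<in> slab t f i" "x \<in> slab t f j" for i j x
  proof -
    have "real i < real j + 1" "real j < real i + 1"
      using that assms mult_less_cancel_left_pos[OF assms] unfolding slab_def
      by (blast intro: less_trans)+
    then show ?thesis by linarith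
  qed
  then show ?thesis by (auto simp: disjoint_family_on_def)
qed

text \<open>Passing to the closure is harmless because the cutoff vanishes near both ends of the slab: the
  slice is supported in a closed set already contained in the open slab.\<close>

lemma supp_slice_subset_slab:
  assumes f: "continuous_on UNIV f" and t: "0 < t" and d: "0 < d"
  shows "supp (slice t d f j) \<subseteq> slab t f j"
proof -
  let ?C = "{x. t * (real j + d) \<le> norm (f x) \<and> norm (f x) \<le> t * (real j + 1 - d)}"
  have "closed ?C" by (intro closed_Collect_conj closed_Collect_le continuous_intros f)
  then have "supp (slice t d f j) \<subseteq> ?C"
    unfolding supp_def support_on_def
    by (intro closure_minimal) (auto dest: slice_nonzeroD[OF _ t d])
  also have "\<dots> \<subseteq> slab t f j"
  proof -
    have "t * real j < t * (real j + d)" "t * (real j + 1 - d) < t * (real j + 1)" using t d by simp_all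
    then show ?thesis by (auto simp: slab_def)
  qed
  finally show ?thesis .
qed

lemma slice_in_Cc:
  assumes f: "f \<in> Cc" and t: "0 < t" and d: "0 < d" and j: "1 \<le> j"
  shows "slice t d f j \<in> Cc"
proof -
  have cf: "continuous_on UNIV f" and K: "compact (supp f)" using f by (auto simp: Cc_def)
  have "max (norm (f x)) (t * real j) \<noteq> 0" for x
    using t j by (smt (verit) mult_pos_pos of_nat_0_less_iff less_le_trans zero_less_one
        max.cobounded2 less_numeral_extra(1))
  then have "continuous_on UNIV (slice t d f j)"
    unfolding slice_def plateau_def using t d by (intro continuous_intros cf) auto
  moreover have "supp (slice t d f j) \<subseteq> supp f"
    unfolding supp_def by (intro closure_mono) (auto simp: support_on_def slice_def)
  then have "compact (supp (slice t d f j))"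
    using K compact_Int_closed[of "supp f" "supp (slice t d f j)"]
    by (simp add: Int_absorb1 supp_def)
  ultimately show ?thesis by (simp add: Cc_def)
qed

section \<open>The interpolating family on slices\<close>

lemma continuous_interp_family:
  assumes "\<And>j. j \<in> {1..N} \<Longrightarrow> h j \<in> Cc"
  shows "continuous_on UNIV (interp_family p0 p1 p N c h z)"
  unfolding interp_family_def using assms by (intro continuous_intros) (auto simp: Cc_def)

lemma interp_family_outside:
  assumes "\<And>j. j \<in> {1..N} \<Longrightarrow> h j x = 0"
  shows "interp_family p0 p1 p N c h z x = 0"
  using assms by (simp add: interp_family_def)

lemma interp_family_inside:
  assumes "k \<in> {1..N}" "\<And>j. j \<in> {1..N} \<Longrightarrow> j \<noteq> k \<Longrightarrow> h j x = 0"
  shows "interp_family p0 p1 p N c h z x = complex_of_real (norm (c k))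
        powr (complex_of_real (p / p0) * (1 - z) + complex_of_real (p * recip p1) * z) * h k x"
proof -
  have "interp_family p0 p1 p N c h z x = (\<Sum>j\<in>{k}. complex_of_real (norm (c j))
        powr (complex_of_real (p / p0) * (1 - z) + complex_of_real (p * recip p1) * z) * h j x)"
    unfolding interp_family_def using assms by (intro sum.mono_neutral_right) auto
  then show ?thesis by simp
qed

abbreviation levels :: "real \<Rightarrow> nat \<Rightarrow> complex"
  where "levels t j \<equiv> complex_of_real (t * real j)"

text \<open>At each point at most one summand is nonzero. The index \<open>k\<close> depends on the point but not on \<open>z\<close>,
  so one case distinction serves all values of \<open>z\<close>.\<close>

lemma norm_interp_family_slices:
  assumes t: "0 < t" and d: "0 < d"
  obtains "\<And>z. norm (interp_family p0 p1 p N (levels t) (slice t d f) z x) = 0"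
  | k where "k \<in> {1..N}" "t * real k < norm (f x)"
    "\<And>z. norm (interp_family p0 p1 p N (levels t) (slice t d f) z x)
       \<le> (t * real k) powr (p / p0 * (1 - Re z) + p * recip p1 * Re z)"
proof (cases "\<exists>k\<in>{1..N}. x \<in> slab t f k")
  case True
  then obtain k where k: "k \<in> {1..N}" "x \<in> slab t f k" by blast
  have "slice t d f j x = 0" if "j \<noteq> k" for j
    using disjoint_slabs[OF t, of f UNIV] that k t d
    by (intro slice_zero_outside_slab) (auto simp: disjoint_family_on_def)
  then have eq: "interp_family p0 p1 p N (levels t) (slice t d f) z x =
      complex_of_real (t * real k) powr (complex_of_real (p / p0) * (1 - z) + complex_of_real (p * recip p1) * z)
      * slice t d f k x" for z
    using interp_family_inside[of k N "slice t d f" x p0 p1 p "levels t" z] k t by (simp add: norm_mult)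
  have pos: "0 < t * real k" using t k by simp
  have "norm (interp_family p0 p1 p N (levels t) (slice t d f) z x)
       \<le> (t * real k) powr (p / p0 * (1 - Re z) + p * recip p1 * Re z)" for z
  proof -
    have "norm (complex_of_real (t * real k) powr (complex_of_real (p / p0) * (1 - z) + complex_of_real (p * recip p1) * z))
       = (t * real k) powr (p / p0 * (1 - Re z) + p * recip p1 * Re z)"
      using pos by (subst norm_powr_real_powr) (auto simp del: of_real_mult of_real_divide)
    then show ?thesis
      unfolding eq norm_mult using norm_slice_le_1[of t d f k x] by (simp add: mult_left_le)
  qed
  with k that(2)[of k] show thesis by (auto simp: slab_def)
next
  case False
  then show thesis
    using slice_zero_outside_slab[OF _ t d, of x f]
    by (intro that(1)) (auto intro!: interp_family_outside)
qed

text \<open>The form in which the size bound is used, with \<open>q = p\<^sub>0\<close> on the line \<open>Re z = 0\<close>, \<open>q = p\<^sub>1\<close> on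
  \<open>Re z = 1\<close>, and \<open>q = p\<close> at \<open>z = \<theta>\<close>. It rests on the constant \<open>t k\<close> being below \<open>|f x|\<close>.\<close>

lemma norm_interp_family_slices_powr_le:
  assumes "0 < t" "0 < d" "0 < p" "0 < q"
    and "q * (p / p0 * (1 - Re z) + p * recip p1 * Re z) = p"
  shows "norm (interp_family p0 p1 p N (levels t) (slice t d f) z x) powr q \<le> norm (f x) powr p"
  using assms(1,2)
proof (cases rule: norm_interp_family_slices[where p = p and ?p0.0 = p0 and ?p1.0 = p1 and N = N and f = f and x = x])
  case (2 k)
  let ?e = "p / p0 * (1 - Re z) + p * recip p1 * Re z"
  have "norm (interp_family p0 p1 p N (levels t) (slice t d f) z x) powr q \<le> ((t * real k) powr ?e) powr q"
    using 2(3)[of z] assms by (intro powr_mono2) auto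
  also have "\<dots> = (t * real k) powr p"
    using assms(5) by (simp add: powr_powr mult.commute)
  also have "\<dots> \<le> norm (f x) powr p"
    using 2(2) assms by (intro powr_mono2) auto
  finally show ?thesis .
qed simp

text \<open>At \<open>z = \<theta>\<close> the sum is \<open>s f x\<close> with a factor \<open>0 \<le> s \<le> 1\<close>, so it never overshoots \<open>f x\<close>. Where the
  cutoff is \<open>1\<close> it is \<open>f x\<close> with its modulus rounded down to a multiple of \<open>t\<close>. The levels run up
  to \<open>N + 1\<close> because the top slab has its upper end at \<open>t (N + 1)\<close>; the level \<open>0\<close> is absent
  because for \<open>|f x| < t\<close> the sum is \<open>0\<close>, which is within \<open>t\<close> of \<open>f x\<close>.\<close>

lemma norm_interp_family_slices_sub_le:
  assumes t: "0 < t" and d: "0 < d"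
    and e: "p / p0 * (1 - \<theta>) + p * recip p1 * \<theta> = 1"
    and N: "norm (f x) < t * (real N + 1)"
  defines "F \<equiv> interp_family p0 p1 p N (levels t) (slice t d f) (complex_of_real \<theta>) x"
  shows "norm (F - f x) \<le> norm (f x)"
    and "(\<And>k. k \<in> {1..N+1} \<Longrightarrow> 2 * d < \<bar>norm (f x) / t - real k\<bar>) \<Longrightarrow> norm (F - f x) \<le> t"
proof -
  have "complex_of_real (p / p0) * (1 - complex_of_real \<theta>) + complex_of_real (p * recip p1) * complex_of_real \<theta>
    = complex_of_real (p / p0 * (1 - \<theta>) + p * recip p1 * \<theta>)" by simp
  then have ce: "complex_of_real (p / p0) * (1 - complex_of_real \<theta>) + complex_of_real (p * recip p1) * complex_of_real \<theta> = 1"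
    unfolding e by simp
  have "norm (F - f x) \<le> norm (f x) \<and>
    ((\<forall>k \<in> {1..N+1}. 2 * d < \<bar>norm (f x) / t - real k\<bar>) \<longrightarrow> norm (F - f x) \<le> t)"
  proof (cases "\<exists>k\<in>{1..N}. x \<in> slab t f k")
    case True
    then obtain k where k: "k \<in> {1..N}" "x \<in> slab t f k" by blast
    have lo: "t * real k < norm (f x)" and hi: "norm (f x) < t * (real k + 1)" using k by (auto simp: slab_def)
    have pos: "0 < t * real k" using t k by simp
    have nz: "norm (f x) > 0" using lo pos by linarith
    have "slice t d f j x = 0" if "j \<noteq> k" for j
      using disjoint_slabs[OF t, of f UNIV] that k t d
      by (intro slice_zero_outside_slab) (auto simp: disjoint_family_on_def)
    then have F: "F = complex_of_real (t * real k) * slice t d f k x"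
      unfolding F_def using t k ce
      by (subst interp_family_inside[of k]) (auto simp: norm_mult powr_to_1)
    (* The factor by which the sum scales f x. *)
    define s where "s = t * real k * plateau d (norm (f x) / t - real k) / norm (f x)"
    have s: "F = of_real s * f x" using lo by (simp add: F slice_def s_def max_absorb1)
    have "0 \<le> s" using pos plateau_nonneg by (simp add: s_def)
    have "t * real k * plateau d (norm (f x) / t - real k) \<le> norm (f x) * 1"
      using lo pos by (intro mult_mono plateau_le_1 plateau_nonneg) auto
    then have "s \<le> 1" using nz by (simp add: s_def divide_le_eq)
    have "F - f x = of_real (s - 1) * f x" by (simp add: s algebra_simps)
    then have nF: "norm (F - f x) = (1 - s) * norm (f x)"
      using \<open>s \<le> 1\<close> by (simp only: norm_mult norm_of_real) simp
    have "norm (F - f x) \<le> norm (f x)" unfolding nF using \<open>0 \<le> s\<close> \<open>s \<le> 1\<close> by (simp add: mult_left_le_one_le)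
    moreover have "norm (F - f x) \<le> t" if good: "\<forall>k \<in> {1..N+1}. 2 * d < \<bar>norm (f x) / t - real k\<bar>"
    proof -
      have "2 * d < \<bar>norm (f x) / t - real k\<bar>" "2 * d < \<bar>norm (f x) / t - real (k + 1)\<bar>"
        using k by (intro good[rule_format]; simp)+
      moreover have "real k < norm (f x) / t" "norm (f x) / t < real k + 1"
        using lo hi t by (simp_all add: field_simps)
      ultimately have "plateau d (norm (f x) / t - real k) = 1" using d by (intro plateau_eq_1) auto
      then have "(1 - s) * norm (f x) = norm (f x) - t * real k" using nz by (simp add: s_def field_simps)
      then show ?thesis using nF hi by (simp add: algebra_simps)
    qed
    ultimately show ?thesis by blast
  next
    case False
    then have "F = 0" unfolding F_def
      using slice_zero_outside_slab[OF _ t d, of x f] by (intro interp_family_outside) auto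
    moreover have "norm (f x) \<le> t" if good: "\<forall>k \<in> {1..N+1}. 2 * d < \<bar>norm (f x) / t - real k\<bar>"
    proof (rule ccontr)
      assume "\<not> norm (f x) \<le> t"
      define k where "k = nat \<lfloor>norm (f x) / t\<rfloor>"
      have u: "1 < norm (f x) / t" "norm (f x) / t < real N + 1"
        using \<open>\<not> norm (f x) \<le> t\<close> N t by (simp_all add: field_simps)
      have k: "real k \<le> norm (f x) / t" "norm (f x) / t < real k + 1" "1 \<le> k"
        unfolding k_def using u by linarith+
      have "k \<in> {1..N}" using k u by simp
      then have "real k \<noteq> norm (f x) / t" using good d by force
      then have "x \<in> slab t f k" using k t by (auto simp: slab_def field_simps)
      then show False using False \<open>k \<in> {1..N}\<close> by blast
    qed
    ultimately show ?thesis by simp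
  qed
  then show "norm (F - f x) \<le> norm (f x)"
    and "(\<And>k. k \<in> {1..N+1} \<Longrightarrow> 2 * d < \<bar>norm (f x) / t - real k\<bar>) \<Longrightarrow> norm (F - f x) \<le> t"
    by blast+
qed

section \<open>Error estimate\<close>

lemma (in metric_measure_space) continuous_imp_measurable:
  fixes g :: "'a \<Rightarrow> 'b::topological_space"
  assumes "continuous_on UNIV g"
  shows "g \<in> borel_measurable M"
proof (rule measurableI)
  fix A :: "'b set" assume "A \<in> sets borel"
  then have "g -` A \<inter> space borel \<in> sets borel"
    by (rule measurable_sets[OF borel_measurable_continuous_onI[OF assms]])
  then show "g -` A \<inter> space M \<in> sets M" using borel_subset space_eq_UNIV by auto
qed simp

lemma (in metric_measure_space) emeasure_nonzero_set_finite:
  assumes "f \<in> Cc"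
  shows "emeasure M {x. f x \<noteq> 0} < \<infinity>"
proof -
  have "bounded (supp f)" using assms by (simp add: Cc_def compact_imp_bounded)
  then obtain a r where r: "supp f \<subseteq> ball a r" "0 < r"
    by (metis bounded_subset_ballD)
  have "{x. f x \<noteq> 0} \<subseteq> supp f"
    unfolding supp_def support_on_def using closure_subset by force
  then have "{x. f x \<noteq> 0} \<subseteq> ball a r" using r by blast
  then have "emeasure M {x. f x \<noteq> 0} \<le> emeasure M (ball a r)"
    using borel_subset by (intro emeasure_mono) auto
  then show ?thesis using finite_ball[OF r(2)] by (meson le_less_trans)
qed

text \<open>The points at which \<open>|f|\<close> is so close to one of the levels \<open>t, \<dots>, n t\<close> that the cutoff of an
  adjacent slab may be below \<open>1\<close>.\<close>

definition collar :: "nat \<Rightarrow> real \<Rightarrow> real \<Rightarrow> ('a \<Rightarrow> complex) \<Rightarrow> 'a set"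
  where "collar n t d f = {x. \<exists>k\<in>{1..n}. \<bar>norm (f x) / t - real k\<bar> \<le> 2 * d}"

lemma (in metric_measure_space) collar_in_sets:
  assumes "f \<in> Cc"
  shows "collar n t d f \<in> sets M"
proof -
  have [measurable]: "f \<in> borel_measurable M"
    using assms by (intro continuous_imp_measurable) (simp add: Cc_def)
  have "{x \<in> space M. \<exists>k\<in>{1..n}. \<bar>norm (f x) / t - real k\<bar> \<le> 2 * d} \<in> sets M"
    by measurable
  then show ?thesis by (simp add: collar_def space_eq_UNIV)
qed

text \<open>Continuity from above. The widths \<open>1 / (m + 3)\<close> start at \<open>1 / 3\<close>, so that \<open>2 * d < 1\<close> and the
  collar around the first level already avoids the zeros of \<open>f\<close>; hence all the collars have finite
  measure. Their intersection is a finite union of level sets of \<open>|f|\<close>.\<close>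

lemma (in metric_measure_space) collar_shrinks:
  assumes f: "f \<in> Cc" and t: "0 < t"
    and null: "\<And>k::nat. 1 \<le> k \<Longrightarrow> emeasure M {x \<in> space M. norm (f x) = t * real k} = 0"
  shows "(\<lambda>m. emeasure M (collar n t (1 / real (m + 3)) f)) \<longlonglongrightarrow> 0"
proof -
  let ?B = "\<lambda>m. collar n t (1 / real (m + 3)) f"
  have [measurable]: "f \<in> borel_measurable M"
    using f by (intro continuous_imp_measurable) (simp add: Cc_def)
  have meas: "range ?B \<subseteq> sets M" using collar_in_sets[OF f] by blast
  have dec: "decseq ?B"
  proof (rule decseq_SucI)
    fix m
    have "2 * (1 / real (Suc m + 3)) \<le> 2 * (1 / real (m + 3))" by (simp add: field_simps)
    then show "?B (Suc m) \<le> ?B m" unfolding collar_def by (blast intro: order_trans)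
  qed
  have fin: "emeasure M (?B m) \<noteq> \<infinity>" for m
  proof -
    have "?B m \<subseteq> {x. f x \<noteq> 0}"
    proof (clarsimp simp: collar_def)
      fix x k assume "f x = 0" "Suc 0 \<le> k" "real k \<le> 2 / (real m + 3)"
      moreover have "2 / (real m + 3) < 1" by simp
      ultimately show False by linarith
    qed
    moreover have "{x \<in> space M. f x \<noteq> 0} \<in> sets M" by measurable
    ultimately have "emeasure M (?B m) \<le> emeasure M {x. f x \<noteq> 0}"
      by (intro emeasure_mono) (auto simp: space_eq_UNIV)
    then show ?thesis using emeasure_nonzero_set_finite[OF f] by (auto simp: top_unique)
  qed
  let ?L = "\<Union>k\<in>{1..n}. {x \<in> space M. norm (f x) = t * real k}"
  have "(\<Inter>m. ?B m) \<subseteq> ?L"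
  proof
    fix x assume x: "x \<in> (\<Inter>m. ?B m)"
    show "x \<in> ?L"
    proof (rule ccontr)
      assume "x \<notin> ?L"
      then have "0 < \<bar>norm (f x) / t - real k\<bar>" if "k \<in> {1..n}" for k
        using t that by (auto simp: space_eq_UNIV field_simps)
      moreover have "(\<lambda>m. 2 * (1 / real (m + 3))) \<longlonglongrightarrow> 0" by real_asymp
      ultimately have "\<forall>\<^sub>F m in sequentially. \<forall>k\<in>{1..n}. 2 * (1 / real (m + 3)) < \<bar>norm (f x) / t - real k\<bar>"
        by (intro eventually_ball_finite) (auto dest!: order_tendstoD(2))
      from eventually_happens'[OF sequentially_bot this] obtain m where "\<forall>k\<in>{1..n}. 2 * (1 / real (m + 3)) < \<bar>norm (f x) / t - real k\<bar>"
        by blast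
      moreover have "x \<in> ?B m" using x by blast
      ultimately show False unfolding collar_def by force
    qed
  qed
  moreover have "?L \<in> null_sets M"
    by (intro null_sets.finite_UN null_setsI null) auto
  ultimately have "emeasure M (\<Inter>m. ?B m) = 0"
    using emeasure_mono[of "\<Inter>m. ?B m" ?L M] by (simp add: null_sets_def)
  then show ?thesis using Lim_emeasure_decseq[OF meas dec fin] by simp
qed

text \<open>The \<open>q\<close>-th power of the error is at most \<open>t powr q\<close> on \<open>{f \<noteq> 0}\<close> off the collar, at most
  \<open>B powr q\<close> on the collar, and \<open>0\<close> elsewhere. Working with \<open>q\<close>-th powers avoids the triangle
  inequality, which fails for \<open>q < 1\<close>.\<close>

lemma (in metric_measure_space) Lp_norm_error_le:
  assumes f: "f \<in> Cc" and t: "0 < t" and d: "0 < d" and q: "0 < q" and \<epsilon>: "0 \<le> \<epsilon>"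
    and e: "p / p0 * (1 - \<theta>) + p * recip p1 * \<theta> = 1"
    and bound: "\<And>x. norm (f x) \<le> B" and N: "B < t * (real N + 1)"
    and small: "ennreal (t powr q) * emeasure M {x. f x \<noteq> 0} \<le> ennreal (\<epsilon> powr q / 2)"
      "ennreal (B powr q) * emeasure M (collar (N + 1) t d f) \<le> ennreal (\<epsilon> powr q / 2)"
  defines "F \<equiv> interp_family p0 p1 p N (levels t) (slice t d f) (complex_of_real \<theta>)"
  shows "Lp_norm M (ennreal q) (\<lambda>x. F x - f x) \<le> ennreal \<epsilon>"
proof (rule Lp_norm_leI[OF q \<epsilon>])
  let ?K = "{x. f x \<noteq> 0}" and ?C = "collar (N + 1) t d f"
  have [measurable]: "f \<in> borel_measurable M"
    using f by (intro continuous_imp_measurable) (simp add: Cc_def)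
  have "{x \<in> space M. f x \<noteq> 0} \<in> sets M" by measurable
  then have K: "?K \<in> sets M" by (simp add: space_eq_UNIV)
  have C: "?C \<in> sets M" by (rule collar_in_sets[OF f])
  have "ennreal (norm (F x - f x) powr q)
      \<le> ennreal (t powr q) * indicator ?K x + ennreal (B powr q) * indicator ?C x" for x
  proof -
    have Nx: "norm (f x) < t * (real N + 1)" using bound[of x] N by linarith
    note err = norm_interp_family_slices_sub_le[where f = f and x = x, OF t d e Nx, folded F_def]
    consider "f x = 0" | "x \<in> ?C" | "f x \<noteq> 0" "x \<notin> ?C" by blast
    then show ?thesis
    proof cases
      case 1
      then show ?thesis using err(1) q by simp
    next
      case 2
      have "norm (F x - f x) powr q \<le> B powr q"
        using err(1) bound[of x] q by (intro powr_mono2) auto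
      then show ?thesis using 2 by (simp add: ennreal_leI add_increasing)
    next
      case 3
      have "norm (F x - f x) powr q \<le> t powr q"
        using err(2) 3(2) q by (intro powr_mono2) (auto simp: collar_def not_le)
      then show ?thesis using 3 by (simp add: ennreal_leI)
    qed
  qed
  then have "(\<integral>\<^sup>+ x. ennreal (norm (F x - f x) powr q) \<partial>M)
      \<le> (\<integral>\<^sup>+ x. ennreal (t powr q) * indicator ?K x + ennreal (B powr q) * indicator ?C x \<partial>M)"
    by (intro nn_integral_mono)
  also have "\<dots> = ennreal (t powr q) * emeasure M ?K + ennreal (B powr q) * emeasure M ?C"
    using K C by (subst nn_integral_add) (auto simp: nn_integral_cmult)
  also have "\<dots> \<le> ennreal (\<epsilon> powr q / 2) + ennreal (\<epsilon> powr q / 2)"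
    by (intro add_mono small)
  also have "\<dots> = ennreal (\<epsilon> powr q)" by (simp flip: ennreal_plus)
  finally show "(\<integral>\<^sup>+ x. ennreal (norm (F x - f x) powr q) \<partial>M) \<le> ennreal (\<epsilon> powr q)" .
qed

text \<open>The order of the choices matters: the mesh \<open>t\<close> makes the rounding error small, the number \<open>N\<close> of
  slabs is then determined by \<open>t\<close> and a bound for \<open>|f|\<close>, and only for this finite set of levels is the
  width \<open>d\<close> chosen.\<close>

lemma (in metric_measure_space) slices_approximate:
  assumes f: "f \<in> Cc" and Q: "finite Q" "\<And>q. q \<in> Q \<Longrightarrow> 0 < q" and \<epsilon>: "0 < \<epsilon>"
    and e: "p / p0 * (1 - \<theta>) + p * recip p1 * \<theta> = 1"
  obtains t d N where "0 < t" "0 < d"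
    "\<And>q. q \<in> Q \<Longrightarrow> Lp_norm M (ennreal q) (\<lambda>x. interp_family p0 p1 p N (levels t) (slice t d f)
        (complex_of_real \<theta>) x - f x) \<le> ennreal \<epsilon>"
proof -
  let ?K = "{x. f x \<noteq> 0}"
  have cf: "continuous_on UNIV f" and cK: "compact (supp f)" using f by (auto simp: Cc_def)
  have meas: "(\<lambda>x. norm (f x)) \<in> borel_measurable M"
    by (intro continuous_imp_measurable continuous_intros cf)
  have fin: "emeasure M ?K < \<infinity>" by (rule emeasure_nonzero_set_finite[OF f])
  obtain B where B: "\<And>x. norm (f x) \<le> B"
  proof -
    have "bounded (f ` supp f)"
      using cK cf by (intro compact_imp_bounded compact_continuous_image) (auto intro: continuous_on_subset)
    then obtain b where b: "0 < b" "\<And>x. x \<in> supp f \<Longrightarrow> norm (f x) \<le> b"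
      unfolding bounded_pos by blast
    have "norm (f x) \<le> b" for x
    proof (cases "f x = 0")
      case False
      then have "x \<in> supp f" unfolding supp_def support_on_def using closure_subset by force
      then show ?thesis by (rule b)
    qed (use b in simp)
    then show thesis by (rule that)
  qed
  have "\<forall>\<^sub>F t in at_right 0. \<forall>q\<in>Q. t powr q * measure M ?K < \<epsilon> powr q / 2"
  proof (intro eventually_ball_finite ballI Q(1))
    fix q assume "q \<in> Q"
    then have "0 < q" by (rule Q)
    then have "((\<lambda>t::real. t powr q) \<longlongrightarrow> 0) (at_right 0)" by real_asymp
    then have "((\<lambda>t. t powr q * measure M ?K) \<longlongrightarrow> 0 * measure M ?K) (at_right 0)"
      by (intro tendsto_intros)
    then show "\<forall>\<^sub>F t in at_right 0. t powr q * measure M ?K < \<epsilon> powr q / 2"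
      using \<epsilon> by (intro order_tendstoD(2)) auto
  qed
  then obtain \<tau> where \<tau>: "0 < \<tau>"
    "\<And>t q. 0 < t \<Longrightarrow> t < \<tau> \<Longrightarrow> q \<in> Q \<Longrightarrow> t powr q * measure M ?K < \<epsilon> powr q / 2"
    unfolding eventually_at_right_field by blast
  obtain t where t: "0 < t" "t < \<tau>"
    and null: "\<And>k::nat. 1 \<le> k \<Longrightarrow> emeasure M {x \<in> space M. norm (f x) = t * real k} = 0"
    using exists_uncharged_mesh[OF meas _ \<tau>(1)] fin by (auto simp: space_eq_UNIV)
  define N where "N = nat \<lceil>B / t\<rceil>"
  have N: "B < t * (real N + 1)"
  proof -
    have "B / t < real N + 1" unfolding N_def by linarith
    then show ?thesis using t(1) by (simp add: field_simps)
  qed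
  have "\<forall>\<^sub>F m in sequentially. \<forall>q\<in>Q.
      ennreal (B powr q) * emeasure M (collar (N + 1) t (1 / real (m + 3)) f) < ennreal (\<epsilon> powr q / 2)"
  proof (intro eventually_ball_finite ballI Q(1))
    fix q
    have "(\<lambda>m. ennreal (B powr q) * emeasure M (collar (N + 1) t (1 / real (m + 3)) f))
        \<longlonglongrightarrow> ennreal (B powr q) * 0"
      by (intro ennreal_tendsto_cmult collar_shrinks f t null) auto
    then show "\<forall>\<^sub>F m in sequentially.
      ennreal (B powr q) * emeasure M (collar (N + 1) t (1 / real (m + 3)) f) < ennreal (\<epsilon> powr q / 2)"
      using \<epsilon> by (intro order_tendstoD(2)) auto
  qed
  from eventually_happens'[OF sequentially_bot this] obtain m where m: "\<And>q. q \<in> Q \<Longrightarrow>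
      ennreal (B powr q) * emeasure M (collar (N + 1) t (1 / real (m + 3)) f) < ennreal (\<epsilon> powr q / 2)"
    by blast
  show thesis
  proof (rule that)
    show "0 < t" by (rule t)
    show "0 < 1 / real (m + 3)" by simp
    fix q assume q: "q \<in> Q"
    have "ennreal (t powr q) * emeasure M ?K = ennreal (t powr q * measure M ?K)"
      using fin by (simp add: emeasure_eq_ennreal_measure ennreal_mult less_top)
    also have "\<dots> \<le> ennreal (\<epsilon> powr q / 2)" using \<tau>(2)[OF t q] by (intro ennreal_leI) simp
    finally show "Lp_norm M (ennreal q) (\<lambda>x. interp_family p0 p1 p N (levels t)
        (slice t (1 / real (m + 3)) f) (complex_of_real \<theta>) x - f x) \<le> ennreal \<epsilon>"
      using \<epsilon> m[OF q] by (intro Lp_norm_error_le[OF f t(1) _ Q(2)[OF q] _ e B N]) auto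
  qed
qed

section \<open>Interpolating families for compactly supported functions\<close>

theorem lemma2p2:
  shows "\<exists>E :: real \<Rightarrow> real \<Rightarrow> ennreal \<Rightarrow> real.
    (\<forall>\<epsilon> p a. 0 \<le> E \<epsilon> p a) \<and>
    (\<forall>p a. ((\<lambda>\<epsilon>. E \<epsilon> p a) \<longlongrightarrow> 0) (at_right 0)) \<and>
    (\<forall>(M :: 'a::metric_space measure) (p0::real) (p1::ennreal) (\<theta>::real) (p::real) f (\<epsilon>::real).
      metric_measure_space M \<longrightarrow>
      0 < p0 \<longrightarrow> ennreal p0 \<le> p1 \<longrightarrow> 0 < \<theta> \<longrightarrow> \<theta> < 1 \<longrightarrow>
      1 / p = (1 - \<theta>) / p0 + \<theta> * recip p1 \<longrightarrow>
      f \<in> Cc \<longrightarrow> 0 < \<epsilon> \<longrightarrow>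
      (\<exists>(N::nat) (h :: nat \<Rightarrow> 'a \<Rightarrow> complex) (U :: nat \<Rightarrow> 'a set) (c :: nat \<Rightarrow> complex).
        (\<forall>j\<in>{1..N}. h j \<in> Cc \<and> open (U j) \<and> supp (h j) \<subseteq> U j \<and> c j \<noteq> 0) \<and>
        disjoint_family_on U {1..N} \<and>
        (let F = interp_family p0 p1 p N c h;
             \<epsilon>' = ennreal (E \<epsilon> p (Lp_norm M (ennreal p) f))
         in
          Lp_norm M (ennreal p0) (\<lambda>x. F (complex_of_real \<theta>) x - f x) \<le> ennreal \<epsilon> \<and>
          (p1 < \<infinity> \<longrightarrow> Lp_norm M p1 (\<lambda>x. F (complex_of_real \<theta>) x - f x) \<le> ennreal \<epsilon>) \<and>
          (p1 = \<infinity> \<longrightarrow> Lp_norm M \<infinity> (F (complex_of_real \<theta>)) \<le> Lp_norm M \<infinity> f + ennreal \<epsilon>) \<and>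
          (\<forall>t::real.
            epow (Lp_norm M (ennreal p0) (F (\<i> * complex_of_real t))) p0
              \<le> epow (Lp_norm M (ennreal p) f) p + \<epsilon>' \<and>
            Lp_norm M p1 (F (1 + \<i> * complex_of_real t))
              \<le> epow (epow (Lp_norm M (ennreal p) f) p + \<epsilon>') (recip p1)))))"
proof -
  have main: "\<exists>(N::nat) (h :: nat \<Rightarrow> 'a \<Rightarrow> complex) (U :: nat \<Rightarrow> 'a set) (c :: nat \<Rightarrow> complex).
        (\<forall>j\<in>{1..N}. h j \<in> Cc \<and> open (U j) \<and> supp (h j) \<subseteq> U j \<and> c j \<noteq> 0) \<and>
        disjoint_family_on U {1..N} \<and>
        (let F = interp_family p0 p1 p N c h; \<epsilon>' = ennreal 0 in
          Lp_norm M (ennreal p0) (\<lambda>x. F (complex_of_real \<theta>) x - f x) \<le> ennreal \<epsilon> \<and>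
          (p1 < \<infinity> \<longrightarrow> Lp_norm M p1 (\<lambda>x. F (complex_of_real \<theta>) x - f x) \<le> ennreal \<epsilon>) \<and>
          (p1 = \<infinity> \<longrightarrow> Lp_norm M \<infinity> (F (complex_of_real \<theta>)) \<le> Lp_norm M \<infinity> f + ennreal \<epsilon>) \<and>
          (\<forall>t::real.
            epow (Lp_norm M (ennreal p0) (F (\<i> * complex_of_real t))) p0
              \<le> epow (Lp_norm M (ennreal p) f) p + \<epsilon>' \<and>
            Lp_norm M p1 (F (1 + \<i> * complex_of_real t))
              \<le> epow (epow (Lp_norm M (ennreal p) f) p + \<epsilon>') (recip p1)))"
    if M: "metric_measure_space M" and p0: "0 < p0" and p01: "ennreal p0 \<le> p1"
      and \<theta>: "0 < \<theta>" "\<theta> < 1" and p_eq: "1 / p = (1 - \<theta>) / p0 + \<theta> * recip p1"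
      and f: "f \<in> Cc" and \<epsilon>: "0 < \<epsilon>"
    for M :: "'a measure" and p0 p1 \<theta> p f \<epsilon>
  proof -
    interpret metric_measure_space M by (rule M)
    have "0 \<le> recip p1" by (simp add: recip_def)
    then have "0 < 1 / p" unfolding p_eq using p0 \<theta> by (intro add_pos_nonneg) auto
    then have p: "0 < p" by simp
    have "p / p0 * (1 - \<theta>) + p * recip p1 * \<theta> = p * (1 / p)"
      unfolding p_eq by (simp add: algebra_simps)
    then have e: "p / p0 * (1 - \<theta>) + p * recip p1 * \<theta> = 1" using p by simp
    define Q where "Q = (if p1 = \<infinity> then {p0} else {p0, enn2real p1})"
    have fin_p1: "0 < enn2real p1 \<and> p1 = ennreal (enn2real p1) \<and> recip p1 = 1 / enn2real p1" if "p1 \<noteq> \<infinity>"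
    proof -
      from that obtain r where r: "p1 = ennreal r" "0 \<le> r" by (cases p1) auto
      then have "0 < r" using p01 p0 by simp
      then show ?thesis using r by (simp add: recip_ennreal)
    qed
    have "finite Q" "\<And>q. q \<in> Q \<Longrightarrow> 0 < q"
      using p0 fin_p1 by (auto simp: Q_def split: if_splits)
    then obtain t d N where t: "0 < t" and d: "0 < d"
      and approx: "\<And>q. q \<in> Q \<Longrightarrow> Lp_norm M (ennreal q) (\<lambda>x. interp_family p0 p1 p N (levels t)
        (slice t d f) (complex_of_real \<theta>) x - f x) \<le> ennreal \<epsilon>"
      by (rule slices_approximate[OF f _ _ \<epsilon> e]) blast+
    define F where "F = interp_family p0 p1 p N (levels t) (slice t d f)"
    have cf: "continuous_on UNIV f" using f by (simp add: Cc_def)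
    have slice: "slice t d f j \<in> Cc" if "j \<in> {1..N}" for j
      using that by (intro slice_in_Cc f t d) auto
    have F_measurable: "(\<lambda>x. ennreal (norm (F z x))) \<in> borel_measurable M" for z
    proof -
      have [measurable]: "F z \<in> borel_measurable M"
        unfolding F_def by (intro continuous_imp_measurable continuous_interp_family slice)
      show ?thesis by measurable
    qed
    have F_powr: "norm (F z x) powr q \<le> norm (f x) powr p"
      if "0 < q" "q * (p / p0 * (1 - Re z) + p * recip p1 * Re z) = p" for z x q
      unfolding F_def by (rule norm_interp_family_slices_powr_le[OF t d p that])
    have F_integral: "(\<integral>\<^sup>+ x. ennreal (norm (F z x) powr q) \<partial>M) \<le> epow (Lp_norm M (ennreal p) f) p"
      if "0 < q" "q * (p / p0 * (1 - Re z) + p * recip p1 * Re z) = p" for z q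
      unfolding epow_Lp_norm[OF p] by (intro nn_integral_mono ennreal_leI F_powr that)
    (* At z = \<theta> the exponent is 1, so q = p gives |F| \<le> |f|. *)
    have sup_\<theta>: "Lp_norm M \<infinity> (F (complex_of_real \<theta>)) \<le> Lp_norm M \<infinity> f + ennreal \<epsilon>"
    proof -
      have "norm (F (complex_of_real \<theta>) x) \<le> norm (f x)" for x
        using F_powr[of p "complex_of_real \<theta>" x] e p powr_less_mono2[OF p norm_ge_zero]
        by (force simp flip: not_less)
      then have "Lp_norm M \<infinity> (F (complex_of_real \<theta>)) \<le> Lp_norm M \<infinity> f"
        unfolding Lp_norm_def by (simp add: esssup_mono F_measurable ennreal_leI)
      then show ?thesis by (simp add: add_increasing2)
    qed
    have left: "epow (Lp_norm M (ennreal p0) (F (\<i> * complex_of_real s))) p0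
        \<le> epow (Lp_norm M (ennreal p) f) p" for s
      unfolding epow_Lp_norm[OF p0, of M "F _"] using p0 by (intro F_integral) auto
    have right: "Lp_norm M p1 (F (1 + \<i> * complex_of_real s))
        \<le> epow (epow (Lp_norm M (ennreal p) f) p) (recip p1)" for s
    proof (cases "p1 = \<infinity>")
      case True
      have "norm (F (1 + \<i> * complex_of_real s) x) \<le> 1" for x
        using t d
      proof (cases rule: norm_interp_family_slices[where p = p and ?p0.0 = p0 and ?p1.0 = p1 and N = N and f = f and x = x])
        case (2 k)
        (* For p1 = \<infinity> the exponent has real part 0 on the line Re z = 1. *)
        have "p / p0 * (1 - Re (1 + \<i> * complex_of_real s)) + p * recip p1 * Re (1 + \<i> * complex_of_real s) = 0"
          using True recip_top by simp
        then show ?thesis using 2(1) 2(3)[of "1 + \<i> * complex_of_real s"] t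
          unfolding F_def by (simp only:) simp
      qed (simp add: F_def)
      then show ?thesis
        using True recip_top by (auto simp: Lp_norm_def epow_def[of _ 0] F_measurable intro!: esssup_I)
    next
      case False
      define r where "r = enn2real p1"
      have r: "0 < r" "p1 = ennreal r" "recip p1 = 1 / r" using fin_p1[OF False] by (simp_all add: r_def)
      show ?thesis
        unfolding r(2) Lp_norm_ennreal[OF r(1)] r(3)[unfolded r(2)]
        using r by (intro epow_mono F_integral) auto
    qed
    show ?thesis
    proof (intro exI conjI ballI)
      fix j assume j: "j \<in> {1..N}"
      show "slice t d f j \<in> Cc" by (rule slice[OF j])
      show "open (slab t f j)" by (rule open_slab[OF cf])
      show "supp (slice t d f j) \<subseteq> slab t f j" by (rule supp_slice_subset_slab[OF cf t d])
      show "levels t j \<noteq> 0" using t j by simp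
    next
      show "disjoint_family_on (slab t f) {1..N}" by (rule disjoint_slabs[OF t])
      have "Lp_norm M (ennreal p0) (\<lambda>x. F (complex_of_real \<theta>) x - f x) \<le> ennreal \<epsilon>"
        unfolding F_def by (rule approx) (simp add: Q_def)
      moreover have "Lp_norm M p1 (\<lambda>x. F (complex_of_real \<theta>) x - f x) \<le> ennreal \<epsilon>" if "p1 < \<infinity>"
        using approx[of "enn2real p1"] fin_p1 that unfolding F_def Q_def by auto
      ultimately show "let F = interp_family p0 p1 p N (levels t) (slice t d f); \<epsilon>' = ennreal 0 in
          Lp_norm M (ennreal p0) (\<lambda>x. F (complex_of_real \<theta>) x - f x) \<le> ennreal \<epsilon> \<and>
          (p1 < \<infinity> \<longrightarrow> Lp_norm M p1 (\<lambda>x. F (complex_of_real \<theta>) x - f x) \<le> ennreal \<epsilon>) \<and>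
          (p1 = \<infinity> \<longrightarrow> Lp_norm M \<infinity> (F (complex_of_real \<theta>)) \<le> Lp_norm M \<infinity> f + ennreal \<epsilon>) \<and>
          (\<forall>t::real.
            epow (Lp_norm M (ennreal p0) (F (\<i> * complex_of_real t))) p0
              \<le> epow (Lp_norm M (ennreal p) f) p + \<epsilon>' \<and>
            Lp_norm M p1 (F (1 + \<i> * complex_of_real t))
              \<le> epow (epow (Lp_norm M (ennreal p) f) p + \<epsilon>') (recip p1))"
        using sup_\<theta> left right unfolding Let_def F_def[symmetric] ennreal_0 add_0_right by blast
    qed
  qed
  show ?thesis
    by (intro exI[of _ "\<lambda>_ _ _. 0"] conjI allI impI main order_refl tendsto_const)
qed

end
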